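(* Let $n\ge 1$ be an integer, let $a>0$, and let $\triangle^n\subset\mathbb{H}^n$ be a regular $n$-simplex with edge length $a$ in the hyperbolic space $\mathbb{H}^n$. Then there exists a closed billiard orbit of period $n+1$ inside $\triangle^n$ (an $(n+1)$-periodic billiard trajectory) which hits the interior of every facet of $\triangle^n$ exactly once.
   Context: $\mathbb{H}^n$ is the $n$-dimensional hyperbolic space (simply connected, complete, constant curvature $-1$) with metric $d$; $[AB]$ denotes the geodesic segment joining $A,B\in\mathbb{H}^n$. A set is convex if it contains $[AB]$ for any two of its points $A,B$; the convex hull of a set is the intersection of all convex sets containing it. An $n$-simplex is the convex hull of $n+1$ points $V_0,\dots,V_n$ (vertices); it is regular if every permutation of its vertices is induced by an isometry of $\mathbb{H}^n$ (equivalently, all distances between distinct vertices are equal). For every $a>0$ there is, up to isometry, a unique regular $n$-simplex of edge length $a$. For $0\le j\le n$ the facet $F_j$ is the convex hull of the vertices $V_k$ with $k\ne j$; $\sigma_j$ denotes the reflection of $\mathbb{H}^n$ (the isometric involution fixing the hyperplane pointwise and interchanging the two half-spaces) with respect to the unique hyperplane (codimension-one totally geodesic subspace) containing $F_j$. A closed billiard orbit of period $n+1$ inside $\triangle^n$ is a closed polygonal curve consisting of geodesic segments, specified by a sequence of points $P_0,\dots,P_n\in\partial\triangle^n$ (indices of the points $P_j$ taken modulo $n+1$) such that: (i) for every $0\le j\le n$ there is a unique index $k(j)\in\{0,\dots,n\}$ with $P_j\in F_{k(j)}$ (so $P_j$ lies in the relative interior of the facet $F_{k(j)}$); (ii) for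 every $0\le j\le n$, $P_j\in[P_{j-1}\,\sigma_{k(j)}(P_{j+1})]$. The orbit hits the interior of every facet exactly once if $j\mapsto k(j)$ is a bijection of $\{0,\dots,n\}$. *)

theory Defs
  imports "HOL-Analysis.Analysis" "HOL-Combinatorics.Permutations"
begin

section \<open>Hyperbolic space: the hyperboloid model\<close>

definition lorentz :: "real \<times> (real^'n) \<Rightarrow> real \<times> (real^'n) \<Rightarrow> real"
  where "lorentz p q = snd p \<bullet> snd q - fst p * fst q"

text \<open>
  The dimension of the space is \<open>CARD('n)\<close>, which is an arbitrary positive integer.
\<close>

typedef (overloaded) ('n::finite) hyp = "{p :: real \<times> (real^'n). lorentz p p = -1 \<and> fst p > 0}"
  morphisms vec_of Abs_hyp
  by (rule exI[of _ "(1, 0)"]) (simp add: lorentz_def)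

lemma lorentz_commute: "lorentz p q = lorentz q p"
  by (simp add: lorentz_def inner_commute)

lemma lorentz_linear [simp]:
  "lorentz (p + q) r = lorentz p r + lorentz q r"
  "lorentz p (q + r) = lorentz p q + lorentz p r"
  "lorentz (p - q) r = lorentz p r - lorentz q r"
  "lorentz p (q - r) = lorentz p q - lorentz p r"
  "lorentz (c *\<^sub>R p) q = c * lorentz p q"
  "lorentz p (c *\<^sub>R q) = c * lorentz p q"
  by (simp_all add: lorentz_def algebra_simps)

lemma lorentz_vec_of [simp]: "lorentz (vec_of X) (vec_of X) = -1"
  using vec_of[of X] by simp

lemma fst_vec_of_pos: "fst (vec_of X) > 0"
  using vec_of[of X] by simp

lemma fst_vec_of_sq: "(fst (vec_of X))\<^sup>2 = 1 + (norm (snd (vec_of X)))\<^sup>2"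
  using lorentz_vec_of[of X]
  unfolding lorentz_def power2_norm_eq_inner power2_eq_square[of "fst _"] by linarith

lemma lorentz_vec_of_aux:
  "(fst (vec_of X) * fst (vec_of Y))\<^sup>2 - (1 + snd (vec_of X) \<bullet> snd (vec_of Y))\<^sup>2 =
     (norm (snd (vec_of X) - snd (vec_of Y)))\<^sup>2
     + ((norm (snd (vec_of X)) * norm (snd (vec_of Y)))\<^sup>2 - (snd (vec_of X) \<bullet> snd (vec_of Y))\<^sup>2)"
proof -
  have Z: "(norm (snd (vec_of X) - snd (vec_of Y)))\<^sup>2 =
      (norm (snd (vec_of X)))\<^sup>2 + (norm (snd (vec_of Y)))\<^sup>2 - 2 * (snd (vec_of X) \<bullet> snd (vec_of Y))"
    by (simp add: power2_norm_eq_inner inner_diff inner_commute)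
  show ?thesis
    unfolding power_mult_distrib fst_vec_of_sq Z by (simp add: power2_eq_square algebra_simps)
qed

lemma inner_sq_le: "(x \<bullet> y)\<^sup>2 \<le> (norm x * norm y)\<^sup>2"
  using Cauchy_Schwarz_ineq[of x y] by (simp add: power_mult_distrib power2_norm_eq_inner)

lemma lorentz_vec_of_le: "lorentz (vec_of X) (vec_of Y) \<le> -1"
proof -
  have "(1 + snd (vec_of X) \<bullet> snd (vec_of Y))\<^sup>2 \<le> (fst (vec_of X) * fst (vec_of Y))\<^sup>2"
    using lorentz_vec_of_aux[of X Y] inner_sq_le[of "snd (vec_of X)" "snd (vec_of Y)"]
      zero_le_power2[of "norm (snd (vec_of X) - snd (vec_of Y))"] by linarith
  then have "1 + snd (vec_of X) \<bullet> snd (vec_of Y) \<le> fst (vec_of X) * fst (vec_of Y)"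
    by (rule power2_le_imp_le) (simp add: fst_vec_of_pos less_imp_le)
  then show ?thesis by (simp add: lorentz_def)
qed

lemma lorentz_vec_of_eq_iff: "lorentz (vec_of X) (vec_of Y) = -1 \<longleftrightarrow> X = Y"
proof
  assume "lorentz (vec_of X) (vec_of Y) = -1"
  then have "fst (vec_of X) * fst (vec_of Y) = 1 + snd (vec_of X) \<bullet> snd (vec_of Y)"
    by (simp add: lorentz_def)
  then have "(fst (vec_of X) * fst (vec_of Y))\<^sup>2 = (1 + snd (vec_of X) \<bullet> snd (vec_of Y))\<^sup>2"
    by simp
  then have "(norm (snd (vec_of X) - snd (vec_of Y)))\<^sup>2 \<le> 0"
    using lorentz_vec_of_aux[of X Y] inner_sq_le[of "snd (vec_of X)" "snd (vec_of Y)"] by linarith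
  then have s: "snd (vec_of X) = snd (vec_of Y)" by simp
  have "(fst (vec_of X))\<^sup>2 = (fst (vec_of Y))\<^sup>2"
    using lorentz_vec_of[of X] lorentz_vec_of[of Y] s
    unfolding lorentz_def power2_eq_square by simp
  then have "fst (vec_of X) = fst (vec_of Y)"
    using fst_vec_of_pos[of X] fst_vec_of_pos[of Y] by (simp add: power2_eq_iff_nonneg)
  with s show "X = Y" by (simp add: prod_eq_iff flip: vec_of_inject)
qed simp

lemma lorentz_nonneg_of_orthogonal:
  assumes "lorentz w (vec_of B) = 0"
  shows "lorentz w w \<ge> 0"
proof -
  let ?t = "fst (vec_of B)" and ?x = "snd (vec_of B)"
  have t: "?t\<^sup>2 = 1 + (norm ?x)\<^sup>2" by (rule fst_vec_of_sq)
  have "fst w * ?t = snd w \<bullet> ?x" using assms by (simp add: lorentz_def)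
  then have "(fst w * ?t)\<^sup>2 \<le> (norm (snd w) * norm ?x)\<^sup>2" by (simp add: inner_sq_le)
  also have "\<dots> \<le> (norm (snd w) * ?t)\<^sup>2"
    unfolding power_mult_distrib t by (simp add: mult_left_mono)
  finally have "(fst w)\<^sup>2 \<le> (norm (snd w))\<^sup>2"
    using fst_vec_of_pos[of B] by (simp add: power_mult_distrib)
  then show ?thesis
    unfolding lorentz_def power2_norm_eq_inner power2_eq_square[of "fst _"] by linarith
qed

lemma lorentz_Cauchy_Schwarz:
  assumes "lorentz v (vec_of B) = 0" "lorentz w (vec_of B) = 0"
  shows "(lorentz v w)\<^sup>2 \<le> lorentz v v * lorentz w w"
proof -
  define a b c where "a = lorentz v v" and "b = lorentz v w" and "c = lorentz w w"
  have q: "r\<^sup>2 * a + 2 * r * s * b + s\<^sup>2 * c \<ge> 0" for r s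
  proof -
    have "lorentz (r *\<^sub>R v + s *\<^sub>R w) (r *\<^sub>R v + s *\<^sub>R w) \<ge> 0"
      by (rule lorentz_nonneg_of_orthogonal[where B = B]) (simp add: assms)
    then show ?thesis
      using lorentz_commute[of w v]
      by (simp add: a_def b_def c_def power2_eq_square algebra_simps)
  qed
  have a: "a \<ge> 0" and c: "c \<ge> 0" using q[of 1 0] q[of 0 1] by simp_all
  have 1: "c * (a * c - b\<^sup>2) \<ge> 0" using q[of c "- b"] by (simp add: power2_eq_square algebra_simps)
  have 2: "a * (a * c - b\<^sup>2) \<ge> 0" using q[of "- b" a] by (simp add: power2_eq_square algebra_simps)
  have "a * c - b\<^sup>2 \<ge> 0"
  proof (cases "a = 0 \<and> c = 0")
    case True
    then have "b = 0" using q[of 1 1] q[of 1 "-1"] by simp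
    then show ?thesis using True by simp
  next
    case False
    then show ?thesis using a c 1 2 by (auto simp: zero_le_mult_iff)
  qed
  then show ?thesis by (simp add: a_def b_def c_def)
qed

instantiation hyp :: (finite) metric_space
begin

definition dist_hyp :: "'a hyp \<Rightarrow> 'a hyp \<Rightarrow> real"
  where "dist_hyp X Y = arcosh (- lorentz (vec_of X) (vec_of Y))"

definition uniformity_hyp :: "('a hyp \<times> 'a hyp) filter"
  where "uniformity_hyp = (INF e\<in>{0<..}. principal {(X, Y). dist X Y < e})"

definition open_hyp :: "'a hyp set \<Rightarrow> bool"
  where "open_hyp U \<longleftrightarrow> (\<forall>X\<in>U. \<forall>\<^sub>F (X', Y) in uniformity. X' = X \<longrightarrow> Y \<in> U)"

instance
proof
  fix A B C :: "'a hyp"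
  show "dist A B = 0 \<longleftrightarrow> A = B"
    using lorentz_vec_of_le[of A B] lorentz_vec_of_eq_iff[of A B] unfolding dist_hyp_def
    by (subst arcosh_eq_0_iff_real) auto
  have triangle: "dist A C \<le> dist A B + dist B C" for A B C :: "'a hyp"
  proof -
    define p q r where "p = - lorentz (vec_of A) (vec_of B)"
      and "q = - lorentz (vec_of B) (vec_of C)" and "r = - lorentz (vec_of A) (vec_of C)"
    have ge: "p \<ge> 1" "q \<ge> 1" "r \<ge> 1"
      using lorentz_vec_of_le[of A B] lorentz_vec_of_le[of B C] lorentz_vec_of_le[of A C]
      by (simp_all add: p_def q_def r_def)
    have comm: "lorentz (vec_of C) (vec_of B) = - q" "lorentz (vec_of B) (vec_of A) = - p"
      "lorentz (vec_of A) (vec_of B) = - p" "lorentz (vec_of B) (vec_of C) = - q"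
      "lorentz (vec_of A) (vec_of C) = - r"
      by (simp_all add: p_def q_def r_def lorentz_commute)
    let ?v = "vec_of A - p *\<^sub>R vec_of B" and ?w = "vec_of C - q *\<^sub>R vec_of B"
    have "(lorentz ?v ?w)\<^sup>2 \<le> lorentz ?v ?v * lorentz ?w ?w"
      by (rule lorentz_Cauchy_Schwarz[where B = B]) (simp_all add: comm)
    then have "(r - p * q)\<^sup>2 \<le> (p\<^sup>2 - 1) * (q\<^sup>2 - 1)"
      by (simp add: comm power2_eq_square algebra_simps)
    then have "r - p * q \<le> sqrt ((p\<^sup>2 - 1) * (q\<^sup>2 - 1))"
      by (rule real_le_rsqrt)
    then have "cosh (arcosh r) \<le> cosh (arcosh p + arcosh q)"
      using ge by (simp add: cosh_add sinh_arcosh_real real_sqrt_mult)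
    then have "arcosh r \<le> arcosh p + arcosh q"
      using ge by (subst (asm) cosh_real_nonneg_le_iff) (simp_all add: add_nonneg_nonneg)
    then show ?thesis by (simp add: dist_hyp_def p_def q_def r_def)
  qed
  show "dist A B \<le> dist A C + dist B C"
    using triangle[of A B C] by (simp add: dist_hyp_def lorentz_commute)
qed (rule uniformity_hyp_def open_hyp_def)+

end

section \<open>Isometries, segments, convex hulls\<close>

definition hyp_isometry :: "(('n::finite) hyp \<Rightarrow> 'n hyp) \<Rightarrow> bool"
  where "hyp_isometry f \<longleftrightarrow> surj f \<and> (\<forall>X Y. dist (f X) (f Y) = dist X Y)"

definition geodesic_path :: "(real \<Rightarrow> ('n::finite) hyp) \<Rightarrow> 'n hyp \<Rightarrow> 'n hyp \<Rightarrow> bool"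
  where "geodesic_path \<gamma> A B \<longleftrightarrow> \<gamma> 0 = A \<and> \<gamma> (dist A B) = B \<and>
    (\<forall>s\<in>{0..dist A B}. \<forall>t\<in>{0..dist A B}. dist (\<gamma> s) (\<gamma> t) = \<bar>s - t\<bar>)"

text \<open>
  Points of hyperbolic space are joined by exactly one geodesic path, so the union over all
  geodesic paths below is the image of that one path.
\<close>

definition geodesic_segment :: "('n::finite) hyp \<Rightarrow> 'n hyp \<Rightarrow> 'n hyp set"
  where "geodesic_segment A B = (\<Union>\<gamma>\<in>{\<gamma>. geodesic_path \<gamma> A B}. \<gamma> ` {0..dist A B})"

definition hyp_convex :: "('n::finite) hyp set \<Rightarrow> bool"
  where "hyp_convex S \<longleftrightarrow> (\<forall>A\<in>S. \<forall>B\<in>S. geodesic_segment A B \<subseteq> S)"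

definition hyp_convex_hull :: "('n::finite) hyp set \<Rightarrow> 'n hyp set"
  where "hyp_convex_hull S = \<Inter> {T. hyp_convex T \<and> S \<subseteq> T}"

section \<open>Hyperplanes and reflections\<close>

text \<open>
  In the hyperboloid model the hyperplanes (the codimension-one totally geodesic subspaces) are
  the nonempty intersections of the hyperboloid with linear hyperplanes, that is, with the
  Lorentz-orthogonal complements of the vectors \<open>u\<close> with \<open>lorentz u u > 0\<close>; the two half-spaces
  are given by the sign of \<open>lorentz u\<close>.
\<close>

definition hyperplane_of :: "real \<times> (real^'n) \<Rightarrow> ('n::finite) hyp set"
  where "hyperplane_of u = {X. lorentz u (vec_of X) = 0}"

definition halfspace_of :: "real \<times> (real^'n) \<Rightarrow> ('n::finite) hyp set"
  where "halfspace_of u = {X. lorentz u (vec_of X) > 0}"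

definition is_hyperplane :: "('n::finite) hyp set \<Rightarrow> bool"
  where "is_hyperplane S \<longleftrightarrow> (\<exists>u. lorentz u u > 0 \<and> S = hyperplane_of u)"

definition is_reflection :: "('n::finite) hyp set \<Rightarrow> ('n hyp \<Rightarrow> 'n hyp) \<Rightarrow> bool"
  where "is_reflection S f \<longleftrightarrow> hyp_isometry f \<and> (\<forall>X. f (f X) = X) \<and> (\<forall>X\<in>S. f X = X) \<and>
    (\<exists>u. lorentz u u > 0 \<and> S = hyperplane_of u \<and>
         f ` halfspace_of u = halfspace_of (- u) \<and> f ` halfspace_of (- u) = halfspace_of u)"

definition reflection :: "('n::finite) hyp set \<Rightarrow> 'n hyp \<Rightarrow> 'n hyp"
  where "reflection S = (THE f. is_reflection S f)"

section \<open>Regular simplices and billiard orbits\<close>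

text \<open>
  A simplex in dimension \<open>n = CARD('n)\<close> is given by its vertices \<open>V 0, \<dots>, V n\<close>; the values of
  \<open>V\<close> at other indices are irrelevant.
\<close>

definition hyp_simplex :: "(nat \<Rightarrow> ('n::finite) hyp) \<Rightarrow> 'n hyp set"
  where "hyp_simplex V = hyp_convex_hull (V ` {0..CARD('n)})"

definition facet :: "(nat \<Rightarrow> ('n::finite) hyp) \<Rightarrow> nat \<Rightarrow> 'n hyp set"
  where "facet V j = hyp_convex_hull (V ` ({0..CARD('n)} - {j}))"

definition regular_simplex :: "(nat \<Rightarrow> ('n::finite) hyp) \<Rightarrow> bool"
  where "regular_simplex V \<longleftrightarrow>
    (\<forall>\<pi>. \<pi> permutes {0..CARD('n)} \<longrightarrow>
      (\<exists>f. hyp_isometry f \<and> (\<forall>j\<in>{0..CARD('n)}. f (V j) = V (\<pi> j))))"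

definition has_edge_length :: "(nat \<Rightarrow> ('n::finite) hyp) \<Rightarrow> real \<Rightarrow> bool"
  where "has_edge_length V a \<longleftrightarrow>
    (\<forall>i\<in>{0..CARD('n)}. \<forall>j\<in>{0..CARD('n)}. i \<noteq> j \<longrightarrow> dist (V i) (V j) = a)"

definition facet_hyperplane :: "(nat \<Rightarrow> ('n::finite) hyp) \<Rightarrow> nat \<Rightarrow> 'n hyp set"
  where "facet_hyperplane V j = (THE S. is_hyperplane S \<and> facet V j \<subseteq> S)"

definition facet_reflection :: "(nat \<Rightarrow> ('n::finite) hyp) \<Rightarrow> nat \<Rightarrow> 'n hyp \<Rightarrow> 'n hyp"
  where "facet_reflection V j = reflection (facet_hyperplane V j)"

text \<open>
  \<open>P\<close> lists the bounce points and \<open>k j\<close> is the index of the only facet containing \<open>P j\<close>.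
  Indices of \<open>P\<close> are taken modulo \<open>n + 1\<close>, where \<open>n = CARD('n)\<close>; the predecessor of \<open>j\<close> is
  written \<open>(j + n) mod (n + 1)\<close> to avoid truncated subtraction.
\<close>

definition closed_billiard_orbit ::
    "(nat \<Rightarrow> ('n::finite) hyp) \<Rightarrow> (nat \<Rightarrow> 'n hyp) \<Rightarrow> (nat \<Rightarrow> nat) \<Rightarrow> bool"
  where "closed_billiard_orbit V P k \<longleftrightarrow>
    (\<forall>j\<in>{0..CARD('n)}.
       P j \<in> frontier (hyp_simplex V) \<and>
       k j \<in> {0..CARD('n)} \<and> P j \<in> facet V (k j) \<and>
       (\<forall>i\<in>{0..CARD('n)}. P j \<in> facet V i \<longrightarrow> i = k j) \<and>
       P j \<in> geodesic_segment (P ((j + CARD('n)) mod (CARD('n) + 1)))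
               (facet_reflection V (k j) (P ((j + 1) mod (CARD('n) + 1)))))"

end

theory Submission
  imports Defs
begin

text \<open>
  In the hyperboloid model, segments and convex hulls are the traces of convex cones. Put
  \<open>N = n + 1\<close>, \<open>c = cosh a\<close>, \<open>\<tau> = 2 c / (1 + (n - 1) c)\<close>. As the Gram matrix of the vertices is
  invariant under permutations, the reflection in the facet opposite to \<open>V j\<close> maps \<open>V j\<close> to
  \<open>- V j + \<tau> (\<Sum>k \<noteq> j. V k)\<close>. One looks for an orbit with the dihedral symmetry of a cyclic order
  of the vertices: \<open>P j\<close> proportional to \<open>\<Sum>k. w (k - j) V k\<close> with \<open>w\<close> even and \<open>N\<close>-periodic,
  \<open>w 0 = 0\<close>. The law of reflection becomes \<open>w (d + 1) + w (d - 1) + \<tau> w 1 = \<lambda> w d\<close> for \<open>0 < d < N\<close>,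
  which \<open>w d = cosh (s N) - cosh (s (N - 2 d))\<close>, \<open>\<lambda> = 2 cosh (2 s)\<close> solves as soon as
  \<open>2 sinh s cosh (s N) = \<tau> sinh (s n)\<close>. Near \<open>s = 0\<close> the right-hand side is the larger one, because
  \<open>n \<tau> > 2\<close> for \<open>c > 1\<close>; for \<open>sinh s = \<tau> / 2\<close> it is the smaller one.
\<close>

subsection \<open>The Lorentz form\<close>

lemma lorentz_minus [simp]: "lorentz (- p) q = - lorentz p q" "lorentz p (- q) = - lorentz p q"
  by (simp_all add: lorentz_def)

lemma lorentz_zero [simp]: "lorentz 0 q = 0" "lorentz p 0 = 0"
  by (simp_all add: lorentz_def)

lemma lorentz_sum_left: "lorentz (\<Sum>i\<in>I. f i) q = (\<Sum>i\<in>I. lorentz (f i) q)"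
  by (induction I rule: infinite_finite_induct) simp_all

lemma lorentz_sum_right: "lorentz p (\<Sum>i\<in>I. f i) = (\<Sum>i\<in>I. lorentz p (f i))"
  by (induction I rule: infinite_finite_induct) simp_all

text \<open>Reversing the time coordinate of \<open>w\<close> gives a test vector whose pairing with
  \<open>w\<close> is the Euclidean square norm.\<close>

lemma lorentz_nondegenerate:
  assumes "\<And>v. lorentz w v = 0"
  shows "w = 0"
proof -
  have "snd w \<bullet> snd w + fst w * fst w = 0"
    using assms[of "(- fst w, snd w)"] by (simp add: lorentz_def)
  then have "snd w \<bullet> snd w = 0 \<and> fst w * fst w = 0"
    using inner_ge_zero[of "snd w"] zero_le_square[of "fst w"] by linarith
  then show ?thesis by (simp add: prod_eq_iff)
qed

lemma vec_of_Abs_hyp: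
  assumes "lorentz v v = -1" "fst v > 0"
  shows "vec_of (Abs_hyp v) = v"
  using assms by (simp add: Abs_hyp_inverse)

text \<open>Selects the upper sheet: on the lower one \<open>- v\<close> would be a point of
  hyperbolic space, which forces \<open>lorentz v (vec_of X) \<ge> 1\<close>.\<close>

lemma fst_pos_of_lorentz_neg:
  assumes v: "lorentz v v = -1" and neg: "lorentz v (vec_of X) < 0"
  shows "fst v > 0"
proof (rule ccontr)
  assume "\<not> fst v > 0"
  moreover have "fst v \<noteq> 0"
  proof
    assume "fst v = 0"
    then show False using v inner_ge_zero[of "snd v"] by (simp add: lorentz_def)
  qed
  ultimately have "vec_of (Abs_hyp (- v)) = - v"
    using v by (intro vec_of_Abs_hyp) simp_all
  then show False
    using lorentz_vec_of_le[of "Abs_hyp (- v)" X] neg by simp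
qed

section \<open>Future timelike vectors as positive multiples of points\<close>

lemma timelike_eq_scaled_vec_of:
  assumes "lorentz v v < 0" "fst v > 0"
  obtains r X where "r > 0" "v = r *\<^sub>R vec_of X"
proof -
  define r where "r = sqrt (- lorentz v v)"
  have r: "r > 0" "r * r = - lorentz v v"
    using assms(1) by (simp_all add: r_def)
  have "lorentz (inverse r *\<^sub>R v) (inverse r *\<^sub>R v) = inverse (r * r) * lorentz v v"
    by (simp add: mult.assoc)
  also have "\<dots> = -1" using assms(1) by (simp add: r(2))
  finally have "vec_of (Abs_hyp (inverse r *\<^sub>R v)) = inverse r *\<^sub>R v"
    using r(1) assms(2) by (intro vec_of_Abs_hyp) simp_all
  then have "v = r *\<^sub>R vec_of (Abs_hyp (inverse r *\<^sub>R v))"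
    using r(1) by simp
  with r(1) show thesis by (rule that)
qed

text \<open>The future cone is convex, because the mixed term in the Lorentz square is
  nonpositive.\<close>

lemma combination_eq_scaled_vec_of:
  assumes "a \<ge> 0" "b \<ge> 0" "a + b > 0"
  obtains r X where "r > 0" "a *\<^sub>R vec_of A + b *\<^sub>R vec_of B = r *\<^sub>R vec_of X"
proof -
  define v where "v = a *\<^sub>R vec_of A + b *\<^sub>R vec_of B"
  have "lorentz v v = - a\<^sup>2 - b\<^sup>2 + 2 * (a * b) * lorentz (vec_of A) (vec_of B)"
    by (simp add: v_def lorentz_commute[of "vec_of B"] power2_eq_square algebra_simps)
  moreover have "2 * (a * b) * lorentz (vec_of A) (vec_of B) \<le> 0"
    using assms lorentz_vec_of_le[of A B] by (intro mult_nonneg_nonpos) simp_all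
  moreover have "a\<^sup>2 + b\<^sup>2 > 0"
    using assms by (auto simp: sum_power2_gt_zero_iff)
  ultimately have "lorentz v v < 0" by linarith
  moreover have "fst v > 0"
  proof (cases "a = 0")
    case True
    then show ?thesis using assms by (simp add: v_def fst_vec_of_pos)
  next
    case False
    then have "a * fst (vec_of A) > 0" "b * fst (vec_of B) \<ge> 0"
      using assms fst_vec_of_pos[of A] fst_vec_of_pos[of B] by simp_all
    then show ?thesis by (simp add: v_def)
  qed
  ultimately show thesis using that unfolding v_def by (rule timelike_eq_scaled_vec_of)
qed

lemma sum_eq_scaled_vec_of:
  assumes "finite I" "\<And>i. i \<in> I \<Longrightarrow> 0 \<le> x i" "j \<in> I" "x j > 0"
  shows "\<exists>r X. r > 0 \<and> (\<Sum>i\<in>I. x i *\<^sub>R vec_of (V i)) = r *\<^sub>R vec_of X"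
  using assms
proof (induction I arbitrary: j rule: finite_induct)
  case (insert i F)
  show ?case
  proof (cases "\<exists>k\<in>F. x k > 0")
    case True
    then obtain r X where r: "r > 0" "(\<Sum>i\<in>F. x i *\<^sub>R vec_of (V i)) = r *\<^sub>R vec_of X"
      using insert by (metis insertI2)
    from insert.prems have "x i \<ge> 0" by simp
    then have "x i + r > 0" "r \<ge> 0" using r(1) by simp_all
    with \<open>x i \<ge> 0\<close> obtain r' X'
      where "r' > 0" "x i *\<^sub>R vec_of (V i) + r *\<^sub>R vec_of X = r' *\<^sub>R vec_of X'"
      by (metis combination_eq_scaled_vec_of)
    then show ?thesis using insert.hyps r(2) by auto
  next
    case False
    then have "\<forall>k\<in>F. x k = 0" "x i > 0"
      using insert.prems by (force intro: antisym)+
    then show ?thesis using insert.hyps by auto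
  qed
qed simp

lemma vec_of_scaled_eq:
  assumes "vec_of X = r *\<^sub>R vec_of Y" "r \<ge> 0"
  shows "X = Y"
proof -
  have "r\<^sup>2 = 1" using lorentz_vec_of[of X] by (simp add: assms(1) power2_eq_square)
  then have "r = 1" using assms(2) by (auto simp: power2_eq_1_iff)
  then show ?thesis using assms(1) by (simp flip: vec_of_inject)
qed

lemma cosh_dist: "cosh (dist X Y) = - lorentz (vec_of X) (vec_of Y)"
  using lorentz_vec_of_le[of X Y] by (simp add: dist_hyp_def)

subsection \<open>Geodesics and convex hulls\<close>

text \<open>
  Meaningful only for \<open>A \<noteq> B\<close>, since otherwise the divisor is 0. Negative times extend the
  segment from \<open>A\<close> to \<open>B\<close> beyond \<open>A\<close>.
\<close>

definition geodesic_line :: "('n::finite) hyp \<Rightarrow> 'n hyp \<Rightarrow> real \<Rightarrow> 'n hyp"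
  where "geodesic_line A B t = Abs_hyp (cosh t *\<^sub>R vec_of A +
    (sinh t / sinh (dist A B)) *\<^sub>R (vec_of B - cosh (dist A B) *\<^sub>R vec_of A))"

text \<open>The part \<open>w\<close> of \<open>vec_of B\<close> orthogonal to
  \<open>vec_of A\<close> has Lorentz square \<open>(sinh d)\<^sup>2\<close>, so
  \<open>(cosh t)\<^sup>2 - (sinh t)\<^sup>2 = 1\<close> keeps the curve on the hyperboloid.\<close>

lemma vec_of_geodesic_line:
  assumes "A \<noteq> B"
  shows "vec_of (geodesic_line A B t) = cosh t *\<^sub>R vec_of A +
    (sinh t / sinh (dist A B)) *\<^sub>R (vec_of B - cosh (dist A B) *\<^sub>R vec_of A)" (is "_ = ?v")
proof -
  define d where "d = dist A B"
  define w where "w = vec_of B - cosh d *\<^sub>R vec_of A"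
  have d: "sinh d > 0" using assms by (simp add: d_def)
  have AB: "lorentz (vec_of A) (vec_of B) = - cosh d" "lorentz (vec_of B) (vec_of A) = - cosh d"
    by (simp_all add: d_def cosh_dist lorentz_commute)
  have w: "lorentz w w = (sinh d)\<^sup>2" "lorentz w (vec_of A) = 0" "lorentz (vec_of A) w = 0"
    using cosh_square_eq[of d] by (simp_all add: w_def AB power2_eq_square)
  have v: "?v = cosh t *\<^sub>R vec_of A + (sinh t / sinh d) *\<^sub>R w"
    by (simp add: w_def d_def)
  have "lorentz ?v ?v = - ((cosh t)\<^sup>2) + (sinh t)\<^sup>2"
    unfolding v using d by (simp add: w power2_eq_square)
  then have 1: "lorentz ?v ?v = -1" by (simp add: cosh_square_eq)
  have "lorentz ?v (vec_of A) < 0"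
    unfolding v by (simp add: w)
  from fst_pos_of_lorentz_neg[OF 1 this] 1 show ?thesis
    unfolding geodesic_line_def by (intro vec_of_Abs_hyp)
qed

text \<open>In this form both coefficients are visibly nonnegative for \<open>t\<close> between 0
  and \<open>dist A B\<close>.\<close>

lemma vec_of_geodesic_line':
  assumes "A \<noteq> B"
  shows "vec_of (geodesic_line A B t) = (sinh (dist A B - t) / sinh (dist A B)) *\<^sub>R vec_of A +
    (sinh t / sinh (dist A B)) *\<^sub>R vec_of B"
proof -
  have "sinh (dist A B) > 0" using assms by simp
  then have *: "sinh (dist A B - t) / sinh (dist A B) =
      cosh t - sinh t / sinh (dist A B) * cosh (dist A B)"
    by (simp add: sinh_diff field_simps)
  show ?thesis
    unfolding vec_of_geodesic_line[OF assms] * by (simp add: algebra_simps)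
qed

lemma dist_geodesic_line:
  assumes "A \<noteq> B"
  shows "dist (geodesic_line A B s) (geodesic_line A B t) = \<bar>s - t\<bar>"
proof -
  define d where "d = dist A B"
  define w where "w = vec_of B - cosh d *\<^sub>R vec_of A"
  have d: "sinh d > 0" using assms by (simp add: d_def)
  have AB: "lorentz (vec_of A) (vec_of B) = - cosh d" "lorentz (vec_of B) (vec_of A) = - cosh d"
    by (simp_all add: d_def cosh_dist lorentz_commute)
  have w: "lorentz w w = (sinh d)\<^sup>2" "lorentz w (vec_of A) = 0" "lorentz (vec_of A) w = 0"
    using cosh_square_eq[of d] by (simp_all add: w_def AB power2_eq_square)
  have v: "vec_of (geodesic_line A B t) = cosh t *\<^sub>R vec_of A + (sinh t / sinh d) *\<^sub>R w" for t
    by (simp add: w_def d_def vec_of_geodesic_line[OF assms])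
  have "cosh (dist (geodesic_line A B s) (geodesic_line A B t)) = cosh (s - t)"
    unfolding cosh_dist v using d by (simp add: w power2_eq_square cosh_diff)
  then have "cosh (dist (geodesic_line A B s) (geodesic_line A B t)) = cosh \<bar>s - t\<bar>"
    by simp
  then show ?thesis
    by (metis abs_ge_zero cosh_real_nonneg_le_iff order_antisym order_refl zero_le_dist)
qed

lemma geodesic_line_0 [simp]: "A \<noteq> B \<Longrightarrow> geodesic_line A B 0 = A"
  by (simp add: vec_of_geodesic_line flip: vec_of_inject)

lemma geodesic_line_dist [simp]: "A \<noteq> B \<Longrightarrow> geodesic_line A B (dist A B) = B"
  by (simp add: vec_of_geodesic_line' flip: vec_of_inject)

text \<open>
  The two points have Lorentz product -1, by the addition theorem for \<open>sinh\<close>: the second one is a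
  combination of \<open>A\<close> and \<open>B\<close>, and the distances of the first one from \<open>A\<close> and \<open>B\<close> are known.
\<close>

lemma geodesic_path_eq_geodesic_line:
  assumes "A \<noteq> B" "geodesic_path \<gamma> A B" "t \<in> {0..dist A B}"
  shows "\<gamma> t = geodesic_line A B t"
proof -
  define d where "d = dist A B"
  have d: "sinh d > 0" using assms by (simp add: d_def)
  have "\<forall>s\<in>{0..d}. dist (\<gamma> t) (\<gamma> s) = \<bar>t - s\<bar>"
    using assms unfolding geodesic_path_def d_def by blast
  moreover have "0 \<in> {0..d}" "d \<in> {0..d}" by (simp_all add: d_def)
  ultimately have "dist (\<gamma> t) (\<gamma> 0) = \<bar>t - 0\<bar>" "dist (\<gamma> t) (\<gamma> d) = \<bar>t - d\<bar>"
    by blast+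
  then have "cosh (dist (\<gamma> t) A) = cosh t" "cosh (dist (\<gamma> t) B) = cosh (d - t)"
    using assms by (auto simp: geodesic_path_def d_def)
  then have "lorentz (vec_of (\<gamma> t)) (vec_of A) = - cosh t"
    "lorentz (vec_of (\<gamma> t)) (vec_of B) = - cosh (d - t)"
    by (simp_all add: cosh_dist)
  then have "lorentz (vec_of (\<gamma> t)) (vec_of (geodesic_line A B t))
      = - (sinh (d - t) * cosh t + sinh t * cosh (d - t)) / sinh d"
    by (simp add: vec_of_geodesic_line'[OF assms(1)] d_def divide_simps algebra_simps)
  also have "sinh (d - t) * cosh t + sinh t * cosh (d - t) = sinh d"
    using sinh_add[of "d - t" t] by (simp add: mult.commute)
  finally show ?thesis using d by (simp add: lorentz_vec_of_eq_iff)
qed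

text \<open>Turns membership in a segment into a linear condition; the law of reflection is checked
  in this form.\<close>

lemma geodesic_segment_eq:
  "geodesic_segment A B =
    {X. \<exists>\<alpha> \<beta>. 0 \<le> \<alpha> \<and> 0 \<le> \<beta> \<and> vec_of X = \<alpha> *\<^sub>R vec_of A + \<beta> *\<^sub>R vec_of B}"
proof (cases "A = B")
  case True
  have "geodesic_path (\<lambda>_. A) A A" by (simp add: geodesic_path_def)
  then have "geodesic_segment A A = {A}"
    by (auto simp: geodesic_segment_def geodesic_path_def)
  moreover have "X = A" if "0 \<le> \<alpha>" "0 \<le> \<beta>" "vec_of X = \<alpha> *\<^sub>R vec_of A + \<beta> *\<^sub>R vec_of A" for X \<alpha> \<beta>
    using that by (intro vec_of_scaled_eq[of X "\<alpha> + \<beta>"]) (simp_all add: scaleR_add_left)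
  moreover have "\<exists>\<alpha> \<beta>. 0 \<le> \<alpha> \<and> 0 \<le> \<beta> \<and> vec_of A = \<alpha> *\<^sub>R vec_of A + \<beta> *\<^sub>R vec_of A"
    by (rule exI[of _ 1], rule exI[of _ 0]) simp
  ultimately show ?thesis using True by auto
next
  case False
  define d where "d = dist A B"
  have d: "d > 0" "sinh d > 0" using False by (simp_all add: d_def)
  have "geodesic_path (geodesic_line A B) A B"
    using False by (simp add: geodesic_path_def dist_geodesic_line)
  moreover have "\<gamma> ` {0..d} = geodesic_line A B ` {0..d}" if "geodesic_path \<gamma> A B" for \<gamma>
    using geodesic_path_eq_geodesic_line[OF False that] by (intro image_cong) (simp_all add: d_def)
  ultimately have seg: "geodesic_segment A B = geodesic_line A B ` {0..d}"
    unfolding geodesic_segment_def d_def[symmetric] by blast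
  show ?thesis
  proof (intro equalityI subsetI)
    fix X assume "X \<in> geodesic_segment A B"
    then obtain t where t: "t \<in> {0..d}" "X = geodesic_line A B t" unfolding seg by blast
    have "0 \<le> sinh (d - t) / sinh d" "0 \<le> sinh t / sinh d"
      using t(1) d by simp_all
    then show "X \<in> {X. \<exists>\<alpha> \<beta>. 0 \<le> \<alpha> \<and> 0 \<le> \<beta> \<and> vec_of X = \<alpha> *\<^sub>R vec_of A + \<beta> *\<^sub>R vec_of B}"
      using vec_of_geodesic_line'[OF False, of t, folded d_def t(2)]
      by (intro CollectI exI[of _ "sinh (d - t) / sinh d"] exI[of _ "sinh t / sinh d"] conjI)
  next
    fix X assume "X \<in> {X. \<exists>\<alpha> \<beta>. 0 \<le> \<alpha> \<and> 0 \<le> \<beta> \<and> vec_of X = \<alpha> *\<^sub>R vec_of A + \<beta> *\<^sub>R vec_of B}"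
    then obtain \<alpha> \<beta> where ab: "0 \<le> \<alpha>" "0 \<le> \<beta>"
      and X: "vec_of X = \<alpha> *\<^sub>R vec_of A + \<beta> *\<^sub>R vec_of B" by blast
    \<comment> \<open>The parameter can only be the distance from \<open>A\<close>. The norm
      equation yields \<open>sinh t = \<beta> * sinh d\<close> and \<open>\<beta> \<le> 1\<close>,
      hence \<open>t \<le> d\<close>.\<close>
    define t where "t = dist A X"
    have AB: "lorentz (vec_of A) (vec_of B) = - cosh d" "lorentz (vec_of B) (vec_of A) = - cosh d"
      by (simp_all add: d_def cosh_dist lorentz_commute)
    have norm: "\<alpha>\<^sup>2 + \<beta>\<^sup>2 + 2 * (\<alpha> * \<beta> * cosh d) = 1"
      using lorentz_vec_of[of X] by (simp add: X AB power2_eq_square algebra_simps)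
    have ct: "cosh t = \<alpha> + \<beta> * cosh d"
      by (simp add: t_def cosh_dist X AB)
    have "(sinh t)\<^sup>2 = (cosh t)\<^sup>2 - 1" by (simp add: sinh_square_eq)
    also have "\<dots> = (\<beta>\<^sup>2 * (cosh d)\<^sup>2 - \<beta>\<^sup>2) + (\<alpha>\<^sup>2 + \<beta>\<^sup>2 + 2 * (\<alpha> * \<beta> * cosh d)) - 1"
      unfolding ct by (simp add: power2_eq_square algebra_simps)
    also have "\<dots> = (\<beta> * sinh d)\<^sup>2"
      unfolding norm by (simp add: power_mult_distrib sinh_square_eq algebra_simps)
    finally have st: "sinh t = \<beta> * sinh d"
      using ab d by (simp add: t_def)
    have "\<alpha> * \<beta> * cosh d \<ge> 0" using ab by simp
    then have "\<beta>\<^sup>2 \<le> 1" using norm zero_le_power2[of \<alpha>] by linarith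
    then have "\<beta> \<le> 1" by (metis abs_le_square_iff abs_one one_power2 abs_ge_self order_trans)
    then have "\<beta> * sinh d \<le> 1 * sinh d" using d by (intro mult_right_mono) simp_all
    then have "sinh t \<le> sinh d" using st by simp
    then have "t \<in> {0..d}" by (simp add: t_def)
    moreover have "X = geodesic_line A B t"
      using d by (simp add: vec_of_geodesic_line[OF False] X ct st algebra_simps
          flip: vec_of_inject d_def)
    ultimately show "X \<in> geodesic_segment A B"
      unfolding seg by (rule rev_image_eqI)
  qed
qed

text \<open>The trace of a cone is convex, which gives one inclusion. For the other, induction
  splits off one vertex, rescales the remaining sum to a point \<open>Y\<close> of the convex set,
  and places \<open>X\<close> on the segment from the vertex to \<open>Y\<close>.\<close>

lemma hyp_convex_hull_eq:
  assumes "finite I"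
  shows "hyp_convex_hull (V ` I) =
    {X. \<exists>x. (\<forall>i\<in>I. 0 \<le> x i) \<and> vec_of X = (\<Sum>i\<in>I. x i *\<^sub>R vec_of (V i))}" (is "_ = ?C")
proof (intro equalityI subsetI)
  have "hyp_convex ?C"
    unfolding hyp_convex_def
  proof (intro ballI subsetI)
    fix A B X assume "A \<in> ?C" "B \<in> ?C" "X \<in> geodesic_segment A B"
    then obtain x y \<alpha> \<beta> where "\<forall>i\<in>I. 0 \<le> x i" "vec_of A = (\<Sum>i\<in>I. x i *\<^sub>R vec_of (V i))"
      "\<forall>i\<in>I. 0 \<le> y i" "vec_of B = (\<Sum>i\<in>I. y i *\<^sub>R vec_of (V i))"
      "0 \<le> \<alpha>" "0 \<le> \<beta>" "vec_of X = \<alpha> *\<^sub>R vec_of A + \<beta> *\<^sub>R vec_of B"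
      unfolding geodesic_segment_eq by blast
    then show "X \<in> ?C"
      by (intro CollectI exI[of _ "\<lambda>i. \<alpha> * x i + \<beta> * y i"])
        (simp add: scaleR_sum_right sum.distrib scaleR_add_left)
  qed
  moreover have "V ` I \<subseteq> ?C"
  proof (intro subsetI, elim imageE)
    fix X i assume "X = V i" "i \<in> I"
    moreover have "(\<Sum>k\<in>I. (if k = i then 1 else 0) *\<^sub>R vec_of (V k)) =
        (\<Sum>k\<in>I. if k = i then vec_of (V k) else 0)"
      by (rule sum.cong) simp_all
    ultimately show "X \<in> ?C"
      using assms by (intro CollectI exI[of _ "\<lambda>k. if k = i then 1 else 0"]) simp
  qed
  ultimately show "X \<in> ?C" if "X \<in> hyp_convex_hull (V ` I)" for X
    using that unfolding hyp_convex_hull_def by blast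
next
  have main: "X \<in> T" if "hyp_convex T" "V ` I \<subseteq> T" "\<forall>i\<in>I. 0 \<le> x i"
    "vec_of X = (\<Sum>i\<in>I. x i *\<^sub>R vec_of (V i))" for X x T
    using assms that
  proof (induction I arbitrary: X x rule: finite_induct)
    \<comment> \<open>The empty combination is 0, which has Lorentz square 0 and represents no
      point.\<close>
    case empty
    then show ?case using lorentz_vec_of[of X] by simp
  next
    case (insert i F)
    show ?case
    proof (cases "\<exists>k\<in>F. x k > 0")
      case True
      then obtain k where k: "k \<in> F" "x k > 0" by blast
      then obtain r Y where r: "r > 0" "(\<Sum>i\<in>F. x i *\<^sub>R vec_of (V i)) = r *\<^sub>R vec_of Y"
        using sum_eq_scaled_vec_of[where x = x and V = V and I = F] insert.hyps insert.prems(3)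
        by blast
      have "vec_of Y = (\<Sum>i\<in>F. (inverse r * x i) *\<^sub>R vec_of (V i))"
        unfolding scaleR_scaleR[symmetric] scaleR_sum_right[symmetric] r(2) using r(1) by simp
      then have "Y \<in> T"
        using insert.prems r(1) by (intro insert.IH[of "\<lambda>i. inverse r * x i"]) auto
      moreover have "V i \<in> T" using insert.prems by simp
      moreover have "X \<in> geodesic_segment (V i) Y"
        unfolding geodesic_segment_eq using insert r
        by (intro CollectI exI[of _ "x i"] exI[of _ r]) simp
      ultimately show ?thesis using insert.prems(1) unfolding hyp_convex_def by blast
    next
      case False
      then have "\<forall>k\<in>F. x k = 0"
        using insert.prems by (force intro: antisym)
      then have "vec_of X = x i *\<^sub>R vec_of (V i)"
        using insert by simp
      then have "X = V i" using insert.prems by (intro vec_of_scaled_eq) auto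
      then show ?thesis using insert.prems by simp
    qed
  qed
  show "X \<in> hyp_convex_hull (V ` I)" if "X \<in> ?C" for X
    using that main unfolding hyp_convex_hull_def by blast
qed

subsection \<open>Reflections and facets\<close>

text \<open>The linear reflection in the Lorentz-orthogonal complement of \<open>u\<close>: an
  explicit candidate for what \<open>reflection\<close> defines by description.\<close>

definition hyp_refl :: "real \<times> (real^'n) \<Rightarrow> ('n::finite) hyp \<Rightarrow> 'n hyp"
  where "hyp_refl u X = Abs_hyp (vec_of X - (2 * lorentz u (vec_of X) / lorentz u u) *\<^sub>R u)"

lemma vec_of_hyp_refl:
  assumes "lorentz u u > 0"
  shows "vec_of (hyp_refl u X) = vec_of X - (2 * lorentz u (vec_of X) / lorentz u u) *\<^sub>R u"
    (is "_ = ?v")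
proof -
  have "lorentz ?v ?v = -1"
    using assms by (simp add: lorentz_commute[of "vec_of _" u] field_simps)
  moreover have "lorentz ?v (vec_of X) = -1 - 2 * (lorentz u (vec_of X))\<^sup>2 / lorentz u u"
    by (simp add: power2_eq_square)
  then have "lorentz ?v (vec_of X) < 0"
    using assms by (smt (verit) divide_nonneg_pos zero_le_power2)
  ultimately show ?thesis
    unfolding hyp_refl_def using fst_pos_of_lorentz_neg by (intro vec_of_Abs_hyp) blast+
qed

lemma lorentz_hyp_refl:
  assumes "lorentz u u > 0"
  shows "lorentz u (vec_of (hyp_refl u X)) = - lorentz u (vec_of X)"
  using assms by (simp add: vec_of_hyp_refl)

lemma hyp_refl_hyp_refl:
  assumes "lorentz u u > 0"
  shows "hyp_refl u (hyp_refl u X) = X"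
  using assms by (simp add: vec_of_hyp_refl[of u "hyp_refl u X"] lorentz_hyp_refl vec_of_hyp_refl
      flip: vec_of_inject)

lemma is_reflection_hyp_refl:
  assumes "lorentz u u > 0"
  shows "is_reflection (hyperplane_of u) (hyp_refl u)"
  unfolding is_reflection_def
proof (intro conjI allI ballI exI[of _ u])
  have "lorentz (vec_of (hyp_refl u X)) (vec_of (hyp_refl u Y)) = lorentz (vec_of X) (vec_of Y)"
    for X Y
    using assms by (simp add: vec_of_hyp_refl lorentz_commute[of "vec_of _" u] field_simps)
  moreover have "surj (hyp_refl u)"
    using hyp_refl_hyp_refl[OF assms] by (rule surjI)
  ultimately show "hyp_isometry (hyp_refl u)"
    by (simp add: hyp_isometry_def dist_hyp_def)
  show "hyp_refl u X = X" if "X \<in> hyperplane_of u" for X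
    using that assms by (simp add: hyperplane_of_def vec_of_hyp_refl flip: vec_of_inject)
  \<comment> \<open>Inclusions suffice: applying the involution to either one gives the reverse of
    the other.\<close>
  have swap: "hyp_refl u ` halfspace_of u \<subseteq> halfspace_of (- u)"
    "hyp_refl u ` halfspace_of (- u) \<subseteq> halfspace_of u"
    by (auto simp: halfspace_of_def lorentz_hyp_refl[OF assms])
  have "hyp_refl u ` hyp_refl u ` S = S" for S
    by (simp add: image_image hyp_refl_hyp_refl[OF assms])
  then show "hyp_refl u ` halfspace_of u = halfspace_of (- u)"
    "hyp_refl u ` halfspace_of (- u) = halfspace_of u"
    using swap image_mono[OF swap(1), of "hyp_refl u"] image_mono[OF swap(2), of "hyp_refl u"]
    by (metis subset_antisym)+
qed (simp_all add: assms hyp_refl_hyp_refl)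

text \<open>Up to positive factors the \<open>u j\<close> are the Lorentz-dual basis of the
  vertices, so pairing with \<open>u j\<close> reads off the coefficient of \<open>V j\<close>. Each
  \<open>u j\<close> is an inward normal of the facet opposite to \<open>V j\<close>.\<close>

locale hyp_simplex_with_normals =
  fixes V :: "nat \<Rightarrow> ('n::finite) hyp" and u :: "nat \<Rightarrow> real \<times> (real^'n)"
  assumes normal_orthogonal:
      "i \<in> {0..CARD('n)} \<Longrightarrow> j \<in> {0..CARD('n)} \<Longrightarrow> i \<noteq> j \<Longrightarrow> lorentz (u j) (vec_of (V i)) = 0"
    and normal_pos: "j \<in> {0..CARD('n)} \<Longrightarrow> lorentz (u j) (vec_of (V j)) > 0"
    and normal_spacelike: "j \<in> {0..CARD('n)} \<Longrightarrow> lorentz (u j) (u j) > 0"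
begin

lemma lorentz_normal_sum:
  assumes "j \<in> {0..CARD('n)}" "I \<subseteq> {0..CARD('n)}"
  shows "lorentz (u j) (\<Sum>i\<in>I. x i *\<^sub>R vec_of (V i)) =
    (if j \<in> I then x j * lorentz (u j) (vec_of (V j)) else 0)"
proof -
  have "lorentz (u j) (\<Sum>i\<in>I. x i *\<^sub>R vec_of (V i)) =
      (\<Sum>i\<in>I. if i = j then x j * lorentz (u j) (vec_of (V j)) else 0)"
    unfolding lorentz_sum_right using assms normal_orthogonal by (intro sum.cong) auto
  then show ?thesis using finite_subset[OF assms(2)] by simp
qed

lemma inj_on_vertices: "inj_on (\<lambda>i. vec_of (V i)) {0..CARD('n)}"
  by (rule inj_onI) (metis less_irrefl normal_orthogonal normal_pos)

text \<open>Pairing a linear relation with the normals kills every coefficient, and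
  \<open>n + 1\<close> independent vectors fill the ambient space.\<close>

lemma span_vertices: "span ((\<lambda>i. vec_of (V i)) ` {0..CARD('n)}) = UNIV" (is "span ?B = _")
proof -
  have "independent ?B"
  proof (rule independent_if_scalars_zero)
    fix f v assume 0: "(\<Sum>x\<in>?B. f x *\<^sub>R x) = 0" and "v \<in> ?B"
    then obtain j where j: "j \<in> {0..CARD('n)}" "v = vec_of (V j)" by blast
    have "(\<Sum>i\<in>{0..CARD('n)}. f (vec_of (V i)) *\<^sub>R vec_of (V i)) = 0"
      using 0 by (simp add: sum.reindex[OF inj_on_vertices])
    then show "f v = 0"
      using lorentz_normal_sum[OF j(1) order_refl, of "\<lambda>i. f (vec_of (V i))"] j normal_pos[OF j(1)]
      by simp
  qed simp
  moreover have "dim (UNIV :: (real \<times> (real^'n)) set) \<le> card ?B"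
    by (simp add: card_image[OF inj_on_vertices])
  ultimately show ?thesis
    using card_ge_dim_independent[of ?B UNIV] by auto
qed

text \<open>Subtracting a suitable multiple of \<open>u j\<close> leaves a vector orthogonal to all
  vertices, hence 0. This gives the uniqueness of both the facet hyperplane and the reflection in
  it.\<close>

lemma orthogonal_to_facet:
  assumes j: "j \<in> {0..CARD('n)}"
    and w: "\<And>i. i \<in> {0..CARD('n)} - {j} \<Longrightarrow> lorentz w (vec_of (V i)) = 0"
  obtains s where "w = s *\<^sub>R u j"
proof -
  define s where "s = lorentz w (vec_of (V j)) / lorentz (u j) (vec_of (V j))"
  have *: "lorentz (w - s *\<^sub>R u j) (vec_of (V i)) = 0" if "i \<in> {0..CARD('n)}" for i
  proof (cases "i = j")
    case True
    then show ?thesis using normal_pos[OF j] by (simp add: s_def)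
  next
    case False
    then show ?thesis using that w normal_orthogonal[OF that j] by simp
  qed
  have "lorentz (w - s *\<^sub>R u j) v = 0" for v
  proof (rule span_induct[of v "(\<lambda>i. vec_of (V i)) ` {0..CARD('n)}"])
    show "v \<in> span ((\<lambda>i. vec_of (V i)) ` {0..CARD('n)})" by (simp add: span_vertices)
    show "subspace {v. lorentz (w - s *\<^sub>R u j) v = 0}"
      by (rule subspaceI) (simp_all del: lorentz_linear(3))
  qed (use * in auto)
  then have "w - s *\<^sub>R u j = 0" by (rule lorentz_nondegenerate)
  then show thesis using that[of s] by simp
qed

lemma mem_facet_iff:
  "X \<in> facet V j \<longleftrightarrow> (\<exists>x. (\<forall>i\<in>{0..CARD('n)} - {j}. 0 \<le> x i) \<and>
     vec_of X = (\<Sum>i\<in>{0..CARD('n)} - {j}. x i *\<^sub>R vec_of (V i)))"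
  by (simp add: facet_def hyp_convex_hull_eq)

lemma vertex_in_facet:
  assumes "i \<in> {0..CARD('n)} - {j}"
  shows "V i \<in> facet V j"
  using assms unfolding facet_def hyp_convex_hull_def by blast

lemma facet_subset_hyperplane:
  assumes "j \<in> {0..CARD('n)}"
  shows "facet V j \<subseteq> hyperplane_of (u j)"
  using lorentz_normal_sum[OF assms, of "{0..CARD('n)} - {j}"]
  by (auto simp: mem_facet_iff hyperplane_of_def)

lemma facet_hyperplane_eq:
  assumes j: "j \<in> {0..CARD('n)}"
  shows "facet_hyperplane V j = hyperplane_of (u j)"
  unfolding facet_hyperplane_def
proof (rule the_equality)
  show "is_hyperplane (hyperplane_of (u j)) \<and> facet V j \<subseteq> hyperplane_of (u j)"
    using normal_spacelike[OF j] facet_subset_hyperplane[OF j] unfolding is_hyperplane_def by blast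
  fix S assume "is_hyperplane S \<and> facet V j \<subseteq> S"
  then obtain w where w: "lorentz w w > 0" "S = hyperplane_of w" "facet V j \<subseteq> hyperplane_of w"
    by (auto simp: is_hyperplane_def)
  have "lorentz w (vec_of (V i)) = 0" if "i \<in> {0..CARD('n)} - {j}" for i
    using vertex_in_facet[OF that] w(3) by (auto simp: hyperplane_of_def)
  then obtain s where s: "w = s *\<^sub>R u j" by (rule orthogonal_to_facet[OF j])
  then have "s \<noteq> 0" using w(1) by auto
  then show "S = hyperplane_of (u j)" by (simp add: w(2) s hyperplane_of_def)
qed

text \<open>A reflection fixes the vertices of the facet and preserves distances, so it moves
  \<open>X\<close> by a multiple of \<open>u j\<close>. Staying on the hyperboloid leaves only the
  multiple 0 and the expected one; the exchange of half-spaces excludes 0 off the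
  hyperplane.\<close>

lemma facet_reflection_eq:
  assumes j: "j \<in> {0..CARD('n)}"
  shows "facet_reflection V j = hyp_refl (u j)"
  unfolding facet_reflection_def reflection_def facet_hyperplane_eq[OF j]
proof (rule the_equality)
  show "is_reflection (hyperplane_of (u j)) (hyp_refl (u j))"
    by (rule is_reflection_hyp_refl[OF normal_spacelike[OF j]])
  fix f assume f: "is_reflection (hyperplane_of (u j)) f"
  show "f = hyp_refl (u j)"
  proof
    fix X
    show "f X = hyp_refl (u j) X"
    proof (cases "X \<in> hyperplane_of (u j)")
      case True
      then show ?thesis using f is_reflection_hyp_refl[OF normal_spacelike[OF j]]
        by (simp add: is_reflection_def)
    next
      case False
      \<comment> \<open>The definition of a reflection supplies its own normal \<open>w\<close>;
        what it is known to share with \<open>u j\<close> is the hyperplane.\<close>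
      obtain w where w: "hyperplane_of (u j) = hyperplane_of w"
        "f ` halfspace_of w = halfspace_of (- w)" "f ` halfspace_of (- w) = halfspace_of w"
        using f unfolding is_reflection_def by blast
      have "X \<in> halfspace_of w \<or> X \<in> halfspace_of (- w)"
        using False unfolding w(1) by (auto simp: hyperplane_of_def halfspace_of_def)
      then have neq: "f X \<noteq> X"
      proof
        assume "X \<in> halfspace_of w"
        then have "X \<in> halfspace_of w" "f X \<in> halfspace_of (- w)" using w(2) by blast+
        then show ?thesis by (auto simp: halfspace_of_def)
      next
        assume "X \<in> halfspace_of (- w)"
        then have "X \<in> halfspace_of (- w)" "f X \<in> halfspace_of w" using w(3) by blast+
        then show ?thesis by (auto simp: halfspace_of_def)
      qed
      have "lorentz (vec_of (f X) - vec_of X) (vec_of (V i)) = 0" if "i \<in> {0..CARD('n)} - {j}" for i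
      proof -
        have "V i \<in> hyperplane_of (u j)"
          using vertex_in_facet[OF that] facet_subset_hyperplane[OF j] by blast
        then have "f (V i) = V i" using f by (simp add: is_reflection_def)
        then have "dist (f X) (V i) = dist X (V i)"
          using f by (metis is_reflection_def hyp_isometry_def)
        then have "cosh (dist (f X) (V i)) = cosh (dist X (V i))" by simp
        then show ?thesis by (simp add: cosh_dist)
      qed
      then obtain s where "vec_of (f X) - vec_of X = s *\<^sub>R u j"
        by (rule orthogonal_to_facet[OF j])
      then have s: "vec_of (f X) = vec_of X + s *\<^sub>R u j" by (simp add: algebra_simps)
      then have "s \<noteq> 0" using neq by (auto simp flip: vec_of_inject)
      have "s * (2 * lorentz (u j) (vec_of X) + s * lorentz (u j) (u j)) = 0"
        using lorentz_vec_of[of "f X"] unfolding s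
        by (simp add: lorentz_commute[of "vec_of _" "u j"] algebra_simps)
      then have "2 * lorentz (u j) (vec_of X) + s * lorentz (u j) (u j) = 0"
        using \<open>s \<noteq> 0\<close> by (simp only: mult_eq_0_iff simp_thms)
      then have "s = - (2 * lorentz (u j) (vec_of X) / lorentz (u j) (u j))"
        using normal_spacelike[OF j] by (simp add: field_simps)
      then show ?thesis
        using normal_spacelike[OF j] by (simp add: s vec_of_hyp_refl flip: vec_of_inject)
    qed
  qed
qed

lemma facet_subset_simplex: "facet V j \<subseteq> hyp_simplex V"
  unfolding facet_def hyp_simplex_def hyp_convex_hull_def by blast

lemma lorentz_normal_simplex:
  assumes "X \<in> hyp_simplex V" "j \<in> {0..CARD('n)}"
  shows "lorentz (u j) (vec_of X) \<ge> 0"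
  using assms lorentz_normal_sum[OF assms(2) order_refl] normal_pos[OF assms(2)]
  by (auto simp: hyp_simplex_def hyp_convex_hull_eq)

text \<open>The geodesic from \<open>V j\<close> through a point of the facet leaves the simplex at that point.\<close>

lemma facet_subset_frontier:
  assumes j: "j \<in> {0..CARD('n)}" and X: "X \<in> facet V j"
  shows "X \<in> frontier (hyp_simplex V)"
proof -
  have XH: "lorentz (u j) (vec_of X) = 0"
    using facet_subset_hyperplane[OF j] X by (auto simp: hyperplane_of_def)
  have "X \<notin> interior (hyp_simplex V)"
  proof
    assume "X \<in> interior (hyp_simplex V)"
    then obtain e where e: "e > 0" "ball X e \<subseteq> hyp_simplex V"
      by (auto simp: mem_interior)
    have neq: "X \<noteq> V j" using XH normal_pos[OF j] by auto
    \<comment> \<open>Negative time moves away from \<open>V j\<close>; the length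
      \<open>e / 2\<close> keeps \<open>Y\<close> in the ball.\<close>
    define Y where "Y = geodesic_line X (V j) (- (e / 2))"
    have "dist X Y = e / 2"
      using dist_geodesic_line[OF neq, of 0 "- (e / 2)"] neq e(1) by (simp add: Y_def)
    then have "Y \<in> hyp_simplex V" using e by (intro subsetD[OF e(2)]) simp
    then have "lorentz (u j) (vec_of Y) \<ge> 0" using j by (rule lorentz_normal_simplex)
    moreover have "lorentz (u j) (vec_of Y) =
        - (sinh (e / 2) / sinh (dist X (V j)) * lorentz (u j) (vec_of (V j)))"
      by (simp add: Y_def vec_of_geodesic_line[OF neq] XH)
    moreover have "sinh (e / 2) / sinh (dist X (V j)) * lorentz (u j) (vec_of (V j)) > 0"
      using e(1) neq normal_pos[OF j] by simp
    ultimately show False by linarith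
  qed
  moreover have "X \<in> closure (hyp_simplex V)"
    using X facet_subset_simplex closure_subset by blast
  ultimately show ?thesis by (simp add: frontier_def)
qed

end


section \<open>The facet normals of a regular simplex\<close>

text \<open>
  A multiple of the dual basis vector of \<open>V j\<close>, found by solving the linear system given by the Gram
  matrix with entries -1 on and \<open>- c\<close> off the diagonal.
\<close>

definition regular_normal :: "(nat \<Rightarrow> ('n::finite) hyp) \<Rightarrow> real \<Rightarrow> nat \<Rightarrow> real \<times> (real^'n)"
  where "regular_normal V c j = (1 + real CARD('n) * c) *\<^sub>R vec_of (V j)
    - c *\<^sub>R (\<Sum>k\<in>{0..CARD('n)}. vec_of (V k))"

lemma lorentz_regular_normal_vertex:
  fixes V :: "nat \<Rightarrow> ('n::finite) hyp"
  assumes gram: "\<forall>i\<in>{0..CARD('n)}. \<forall>j\<in>{0..CARD('n)}. i \<noteq> j \<longrightarrow>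
      lorentz (vec_of (V i)) (vec_of (V j)) = - c"
    and ij: "i \<in> {0..CARD('n)}" "j \<in> {0..CARD('n)}"
  shows "lorentz (regular_normal V c j) (vec_of (V i)) =
    (if i = j then (1 + real CARD('n) * c) * (c - 1) else 0)"
proof -
  \<comment> \<open>Row sum of the Gram matrix: \<open>- c\<close> everywhere, corrected by
    \<open>c - 1\<close> on the diagonal.\<close>
  have "lorentz (\<Sum>k\<in>{0..CARD('n)}. vec_of (V k)) (vec_of (V i)) =
      (\<Sum>k\<in>{0..CARD('n)}. (if k = i then c - 1 else 0) - c)"
    unfolding lorentz_sum_left using ij gram by (intro sum.cong) auto
  also have "\<dots> = - (1 + real CARD('n) * c)"
    using ij by (simp add: sum_subtractf algebra_simps)
  finally have "lorentz (regular_normal V c j) (vec_of (V i)) =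
      (1 + real CARD('n) * c) * lorentz (vec_of (V j)) (vec_of (V i)) + c * (1 + real CARD('n) * c)"
    by (simp add: regular_normal_def distrib_left right_diff_distrib)
  moreover have "lorentz (vec_of (V j)) (vec_of (V i)) = (if i = j then -1 else - c)"
    using gram ij by simp
  ultimately show ?thesis by (auto simp: algebra_simps)
qed

text \<open>Expanding one argument only reduces the square to pairings with vertices. The value is
  positive for \<open>c > 1\<close>, so the normal is spacelike.\<close>

lemma lorentz_regular_normal_self:
  fixes V :: "nat \<Rightarrow> ('n::finite) hyp"
  assumes gram: "\<forall>i\<in>{0..CARD('n)}. \<forall>j\<in>{0..CARD('n)}. i \<noteq> j \<longrightarrow>
      lorentz (vec_of (V i)) (vec_of (V j)) = - c"
    and j: "j \<in> {0..CARD('n)}"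
  shows "lorentz (regular_normal V c j) (regular_normal V c j) =
    (1 + (real CARD('n) - 1) * c) * ((1 + real CARD('n) * c) * (c - 1))"
proof -
  have "lorentz (regular_normal V c j) (\<Sum>k\<in>{0..CARD('n)}. vec_of (V k)) =
      (\<Sum>k\<in>{0..CARD('n)}. if k = j then (1 + real CARD('n) * c) * (c - 1) else 0)"
    unfolding lorentz_sum_right
    using lorentz_regular_normal_vertex[OF gram _ j] by (intro sum.cong) auto
  then have "lorentz (regular_normal V c j) (\<Sum>k\<in>{0..CARD('n)}. vec_of (V k)) =
      (1 + real CARD('n) * c) * (c - 1)"
    using j by simp
  then have "lorentz (regular_normal V c j) ((1 + real CARD('n) * c) *\<^sub>R vec_of (V j)
      - c *\<^sub>R (\<Sum>k\<in>{0..CARD('n)}. vec_of (V k))) =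
    (1 + real CARD('n) * c) * lorentz (regular_normal V c j) (vec_of (V j))
      - c * ((1 + real CARD('n) * c) * (c - 1))"
    by simp
  also have "\<dots> = (1 + (real CARD('n) - 1) * c) * ((1 + real CARD('n) * c) * (c - 1))"
    by (simp add: lorentz_regular_normal_vertex[OF gram j j] algebra_simps)
  finally show ?thesis unfolding regular_normal_def[of V c j, symmetric] .
qed

subsection \<open>Cyclic weights\<close>

text \<open>The absolute value builds in evenness. Together with the symmetry between
  \<open>d\<close> and \<open>m - d\<close> it replaces periodicity for index differences.\<close>

definition cyclic_weight :: "real \<Rightarrow> real \<Rightarrow> real \<Rightarrow> real"
  where "cyclic_weight s m d = cosh (s * m) - cosh (s * (m - 2 * \<bar>d\<bar>))"

lemma cyclic_weight_0 [simp]: "cyclic_weight s m 0 = 0"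
  by (simp add: cyclic_weight_def)

lemma cyclic_weight_minus: "cyclic_weight s m (- d) = cyclic_weight s m d"
  by (simp add: cyclic_weight_def)

lemma cyclic_weight_reflect:
  assumes "0 \<le> d" "d \<le> m"
  shows "cyclic_weight s m (m - d) = cyclic_weight s m d"
proof -
  have "s * (m - 2 * \<bar>m - d\<bar>) = - (s * (m - 2 * \<bar>d\<bar>))"
    using assms by (simp add: algebra_simps)
  then show ?thesis unfolding cyclic_weight_def by (simp only: cosh_minus)
qed

lemma cyclic_weight_pos:
  assumes "s > 0" "d \<noteq> 0" "\<bar>d\<bar> < m"
  shows "cyclic_weight s m d > 0"
proof -
  have "\<bar>m - 2 * \<bar>d\<bar>\<bar> < m" using assms by arith
  then have "\<bar>s * (m - 2 * \<bar>d\<bar>)\<bar> < s * m"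
    using assms(1) by (simp add: abs_mult)
  then have "cosh \<bar>s * (m - 2 * \<bar>d\<bar>)\<bar> < cosh (s * m)"
    by (subst cosh_real_nonneg_less_iff) simp_all
  then show ?thesis by (simp add: cyclic_weight_def)
qed

text \<open>The term \<open>cosh (s * (m - 2 * d))\<close> satisfies the homogeneous recurrence; the
  constant term misses it by \<open>(2 * cosh (2 * s) - 2) * cosh (s * m)\<close>, which by the
  choice of \<open>s\<close> is \<open>\<tau> * cyclic_weight s m 1\<close>. For
  \<open>\<bar>d\<bar> \<ge> 1\<close> the neighbours of \<open>d\<close> do not cross 0, where the
  absolute value would interfere.\<close>

lemma cyclic_weight_recurrence:
  assumes s: "2 * sinh s * cosh (s * m) = \<tau> * sinh (s * (m - 1))" and m: "m \<ge> 2" and d: "\<bar>d\<bar> \<ge> 1"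
  shows "cyclic_weight s m (d + 1) + cyclic_weight s m (d - 1) + \<tau> * cyclic_weight s m 1
    = 2 * cosh (2 * s) * cyclic_weight s m d"
proof -
  have "cyclic_weight s m 1 = cosh (s * (m - 1) + s) - cosh (s * (m - 1) - s)"
    by (simp add: cyclic_weight_def algebra_simps)
  also have "\<dots> = 2 * sinh s * sinh (s * (m - 1))"
    by (simp add: cosh_add cosh_diff)
  finally have "\<tau> * cyclic_weight s m 1 = 2 * sinh s * (2 * sinh s * cosh (s * m))"
    unfolding s by simp
  also have "\<dots> = (2 * cosh (2 * s) - 2) * cosh (s * m)"
    unfolding cosh_double cosh_square_eq by (simp add: power2_eq_square algebra_simps)
  finally have 1: "\<tau> * cyclic_weight s m 1 = (2 * cosh (2 * s) - 2) * cosh (s * m)" .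
  have *: "cyclic_weight s m (d + 1) + cyclic_weight s m (d - 1) + \<tau> * cyclic_weight s m 1
    = 2 * cosh (2 * s) * cyclic_weight s m d" if "d \<ge> 1" for d
  proof -
    define x where "x = s * (m - 2 * d)"
    have "s * (m - 2 * \<bar>d + 1\<bar>) = x - 2 * s" "s * (m - 2 * \<bar>d - 1\<bar>) = x + 2 * s"
      "s * (m - 2 * \<bar>d\<bar>) = x"
      using that by (simp_all add: x_def algebra_simps)
    then have *: "cyclic_weight s m (d + 1) = cosh (s * m) - cosh (x - 2 * s)"
      "cyclic_weight s m (d - 1) = cosh (s * m) - cosh (x + 2 * s)"
      "cyclic_weight s m d = cosh (s * m) - cosh x"
      by (simp_all only: cyclic_weight_def)
    show ?thesis
      unfolding 1 * cosh_add cosh_diff by (simp add: algebra_simps)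
  qed
  show ?thesis
  proof (cases "d \<ge> 1")
    \<comment> \<open>Evenness exchanges the two neighbours.\<close>
    case False
    then have "- d \<ge> 1" using d by linarith
    have "\<bar>- d + 1\<bar> = \<bar>d - 1\<bar>" "\<bar>- d - 1\<bar> = \<bar>d + 1\<bar>" by arith+
    then have "cyclic_weight s m (- d + 1) = cyclic_weight s m (d - 1)"
      "cyclic_weight s m (- d - 1) = cyclic_weight s m (d + 1)"
      by (simp_all only: cyclic_weight_def)
    with *[OF \<open>- d \<ge> 1\<close>] show ?thesis by (simp only: cyclic_weight_minus add.commute)
  qed (rule *)
qed

text \<open>Only the wrap-around \<open>j = n\<close> needs an argument: evenness and the symmetry
  \<open>d \<mapsto> m - d\<close> carry \<open>k - n - 1\<close> to \<open>k\<close>.\<close>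

lemma cyclic_weight_succ:
  assumes "j \<in> {0..n}" "k \<in> {0..n}"
  shows "cyclic_weight s (real n + 1) (real k - real ((j + 1) mod (n + 1))) =
    cyclic_weight s (real n + 1) (real k - real j - 1)"
proof (cases "j = n")
  case True
  then show ?thesis
    using cyclic_weight_minus[of s "real n + 1" "real k - real j - 1"]
      cyclic_weight_reflect[of "real k" "real n + 1" s] assms
    by (simp add: algebra_simps)
next
  case False
  then show ?thesis using assms by (simp add: algebra_simps)
qed

text \<open>Here the wrap-around occurs at \<open>j = 0\<close>, where the same symmetries carry
  \<open>k - n\<close> to \<open>k + 1\<close>.\<close>

lemma cyclic_weight_pred:
  assumes "j \<in> {0..n}" "k \<in> {0..n}"
  shows "cyclic_weight s (real n + 1) (real k - real ((j + n) mod (n + 1))) =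
    cyclic_weight s (real n + 1) (real k - real j + 1)"
proof (cases j)
  case 0
  then show ?thesis
    using cyclic_weight_minus[of s "real n + 1" "real k - real n"]
      cyclic_weight_reflect[of "real k + 1" "real n + 1" s] assms
    by (simp add: algebra_simps)
next
  case (Suc i)
  then have "(j + n) mod (n + 1) = i" using assms by (simp add: mod_if)
  then show ?thesis using Suc by (simp add: algebra_simps)
qed

lemma ex_sinh_cosh_parameter:
  fixes \<tau> m :: real
  assumes \<tau>: "\<tau> * (m - 1) > 2" and m: "m \<ge> 2"
  shows "\<exists>s>0. 2 * sinh s * cosh (s * m) = \<tau> * sinh (s * (m - 1))"
proof -
  define g where "g s = \<tau> * sinh (s * (m - 1)) - 2 * sinh s * cosh (s * m)" for s
  have "\<tau> > 0" using \<tau> m by (smt (verit) mult_nonpos_nonneg)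
  have "(g has_real_derivative \<tau> * (m - 1) - 2) (at 0)"
    unfolding g_def by (auto intro!: derivative_eq_intros)
  from DERIV_pos_inc_right[OF this] \<tau>
  obtain e where e: "e > 0" "\<And>h. 0 < h \<Longrightarrow> h < e \<Longrightarrow> g 0 < g (0 + h)" by auto
  define b where "b = arsinh (\<tau> / 2)"
  have b: "b > 0" "sinh b = \<tau> / 2" using \<open>\<tau> > 0\<close> by (simp_all add: b_def)
  \<comment> \<open>Starting at \<open>h > 0\<close> excludes the trivial root 0 of
    \<open>g\<close>; the minimum ensures \<open>h \<le> b\<close>.\<close>
  define h where "h = min (e / 2) b"
  have h: "0 < h" "h < e" "h \<le> b" using e(1) b by (auto simp: h_def min_def)
  then have "g h \<ge> 0" using e(2)[of h] by (simp add: g_def)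
  moreover have "g b \<le> 0"
  proof -
    have "sinh (b * (m - 1)) \<le> cosh (b * (m - 1))" by (rule sinh_le_cosh_real)
    also have "\<dots> \<le> cosh (b * m)"
      using b(1) m by (subst cosh_real_nonneg_le_iff) simp_all
    finally show ?thesis using \<open>\<tau> > 0\<close> by (simp add: g_def b(2))
  qed
  moreover have "continuous_on {h..b} g"
    unfolding g_def by (intro continuous_intros)
  ultimately obtain s where "h \<le> s" "g s = 0"
    using IVT2'[of g b 0 h] h(3) by auto
  then show ?thesis using h(1) by (intro exI[of _ s]) (simp add: g_def)
qed

subsection \<open>The billiard orbit\<close>

theorem theorem1p1:
  fixes V :: "nat \<Rightarrow> ('n::finite) hyp" and a :: real
  assumes "a > 0"
    and "regular_simplex V"
    and "has_edge_length V a"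
  shows "\<exists>P k. closed_billiard_orbit V P k \<and> bij_betw k {0..CARD('n)} {0..CARD('n)}"
proof -
  define n where "n = CARD('n)"
  have n: "n \<ge> 1" by (simp add: n_def Suc_leI)
  define c where "c = cosh a"
  have c: "c > 1" using assms(1) cosh_real_nonneg_less_iff[of 0 a] by (simp add: c_def)
  have gram: "\<forall>i\<in>{0..CARD('n)}. \<forall>j\<in>{0..CARD('n)}. i \<noteq> j \<longrightarrow>
      lorentz (vec_of (V i)) (vec_of (V j)) = - c"
  proof (intro ballI impI)
    fix i j assume "i \<in> {0..CARD('n)}" "j \<in> {0..CARD('n)}" "i \<noteq> j"
    then have "dist (V i) (V j) = a" using assms(3) by (simp add: has_edge_length_def)
    then show "lorentz (vec_of (V i)) (vec_of (V j)) = - c"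
      using cosh_dist[of "V i" "V j"] by (simp add: c_def)
  qed
  define u where "u = regular_normal V c"
  \<comment> \<open>\<open>q\<close> is the pairing of a normal with its own vertex, and
    \<open>D * q\<close> is the Lorentz square of a normal.\<close>
  define q where "q = (1 + real n * c) * (c - 1)"
  define D where "D = 1 + (real n - 1) * c"
  have q: "q > 0" using c by (simp add: q_def add_pos_nonneg)
  have D: "D > 0" using c n by (simp add: D_def add_pos_nonneg)
  have uV: "lorentz (u j) (vec_of (V i)) = (if i = j then q else 0)"
    if "i \<in> {0..CARD('n)}" "j \<in> {0..CARD('n)}" for i j
    using lorentz_regular_normal_vertex[OF gram that] by (simp add: u_def q_def n_def)
  have uu: "lorentz (u j) (u j) = D * q" if "j \<in> {0..CARD('n)}" for j
    using lorentz_regular_normal_self[OF gram that] by (simp add: u_def q_def D_def n_def)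
  interpret hyp_simplex_with_normals V u
    by unfold_locales (simp_all add: uV uu q D)

  define \<tau> where "\<tau> = 2 * c / D"
  \<comment> \<open>After multiplication by \<open>D\<close> this is \<open>c > 1\<close>, so it
    rests on the positive edge length.\<close>
  have "\<tau> * (real n + 1 - 1) > 2"
    using c D by (simp add: \<tau>_def D_def field_simps)
  then obtain s where s: "s > 0" "2 * sinh s * cosh (s * (real n + 1)) = \<tau> * sinh (s * (real n + 1 - 1))"
    using ex_sinh_cosh_parameter[of \<tau> "real n + 1"] n by auto
  define w where "w d = cyclic_weight s (real n + 1) d" for d
  \<comment> \<open>The differences are taken in the reals because they may be negative. The weight
    at \<open>V j\<close> is 0, which puts the ray of \<open>W j\<close> into facet
    \<open>j\<close>.\<close>
  define W where "W j = (\<Sum>k\<in>{0..n}. w (real k - real j) *\<^sub>R vec_of (V k))" for j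
  have w_pos: "w (real k - real j) > 0" if "j \<in> {0..n}" "k \<in> {0..n}" "k \<noteq> j" for j k
    unfolding w_def using s(1) that by (intro cyclic_weight_pos) auto
  have w_nonneg: "w (real k - real j) \<ge> 0" if "j \<in> {0..n}" "k \<in> {0..n}" for j k
    using w_pos[OF that] by (cases "k = j") (auto simp: w_def)
  have "\<exists>r X. r > 0 \<and> W j = r *\<^sub>R vec_of X" if j: "j \<in> {0..n}" for j
    unfolding W_def
  proof (rule sum_eq_scaled_vec_of)
    define k where "k = (if j = 0 then 1 else 0 :: nat)"
    show "k \<in> {0..n}" "w (real k - real j) > 0"
      using w_pos[OF j, of k] n by (auto simp: k_def)
  qed (use w_nonneg[OF j] in auto)
  then obtain r P where r: "\<And>j. j \<in> {0..n} \<Longrightarrow> r j > 0"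
    and P: "\<And>j. j \<in> {0..n} \<Longrightarrow> W j = r j *\<^sub>R vec_of (P j)"
    by metis
  have P': "vec_of (P j) = inverse (r j) *\<^sub>R W j" if "j \<in> {0..n}" for j
    using P[OF that] r[OF that] by simp

  have facet: "P j \<in> facet V j" if j: "j \<in> {0..n}" for j
  proof -
    have "vec_of (P j) = (\<Sum>i\<in>{0..n}. (inverse (r j) * w (real i - real j)) *\<^sub>R vec_of (V i))"
      by (simp add: P'[OF j] W_def scaleR_sum_right)
    also have "\<dots> = (\<Sum>i\<in>{0..n} - {j}. (inverse (r j) * w (real i - real j)) *\<^sub>R vec_of (V i))"
      using j by (subst sum.remove[of _ j]) (simp_all add: w_def)
    finally show ?thesis
      using w_nonneg[OF j] r[OF j] unfolding mem_facet_iff n_def[symmetric]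
      by (intro exI[of _ "\<lambda>i. inverse (r j) * w (real i - real j)"]) auto
  qed
  have lorentz_W: "lorentz (u i) (W j) = w (real i - real j) * q" if "i \<in> {0..n}" for i j
    using lorentz_normal_sum[of i "{0..n}"] uV[of i i] that by (simp add: W_def n_def)
  \<comment> \<open>All other coefficients are positive, so the bounce point avoids every other
    facet.\<close>
  have not_facet: "i = j" if "i \<in> {0..n}" "j \<in> {0..n}" "P j \<in> facet V i" for i j
  proof (rule ccontr)
    assume "i \<noteq> j"
    then have "lorentz (u i) (vec_of (P j)) > 0"
      using that w_pos q r by (simp add: P' lorentz_W)
    moreover have "lorentz (u i) (vec_of (P j)) = 0"
      using that facet_subset_hyperplane[of i] by (auto simp: hyperplane_of_def n_def)
    ultimately show False by simp
  qed
  have segment: "P j \<in> geodesic_segment (P ((j + n) mod (n + 1)))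
      (facet_reflection V j (P ((j + 1) mod (n + 1))))" if j: "j \<in> {0..n}" for j
  proof -
    define j1 j2 where "j1 = (j + n) mod (n + 1)" and "j2 = (j + 1) mod (n + 1)"
    have "j1 < n + 1" "j2 < n + 1" unfolding j1_def j2_def by simp_all
    then have j12: "j1 \<in> {0..n}" "j2 \<in> {0..n}" by simp_all
    have w12: "w (real k - real j1) = w (real k - real j + 1)"
      "w (real k - real j2) = w (real k - real j - 1)" if "k \<in> {0..n}" for k
      using that j unfolding w_def j1_def j2_def
      by (simp_all only: cyclic_weight_succ cyclic_weight_pred)
    define x where "x = w 1"
    have wj: "w (real j - real j1) = x" "w (real j - real j2) = x"
      using w12[OF j] cyclic_weight_minus[of s "real n + 1" 1] by (simp_all add: x_def w_def)
    have jn: "j \<in> {0..CARD('n)}" using j by (simp add: n_def)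
    have "vec_of (facet_reflection V j (P j2)) =
        vec_of (P j2) - (2 * lorentz (u j) (vec_of (P j2)) / lorentz (u j) (u j)) *\<^sub>R u j"
      unfolding facet_reflection_eq[OF jn] by (rule vec_of_hyp_refl[OF normal_spacelike[OF jn]])
    also have "2 * lorentz (u j) (vec_of (P j2)) / lorentz (u j) (u j) = inverse (r j2) * (2 * x / D)"
      using q D by (simp add: uu[OF jn] P'[OF j12(2)] lorentz_W[OF j] wj)
    finally have "r j2 *\<^sub>R vec_of (facet_reflection V j (P j2)) = W j2 - (2 * x / D) *\<^sub>R u j"
      using r[OF j12(2)] by (simp add: P[OF j12(2)] scaleR_diff_right)
    \<comment> \<open>Expanded in the vertices, the normal contributes \<open>- \<tau> * x\<close>
      at each vertex and one extra term at \<open>V j\<close>.\<close>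
    also have "(2 * x / D) *\<^sub>R u j =
        (\<Sum>k\<in>{0..n}. ((if k = j then 2 * x / D * (1 + real n * c) else 0) - \<tau> * x) *\<^sub>R vec_of (V k))"
    proof -
      have "(\<Sum>k\<in>{0..n}. (if k = j then 2 * x / D * (1 + real n * c) else 0) *\<^sub>R vec_of (V k)) =
          (\<Sum>k\<in>{0..n}. if k = j then (2 * x / D * (1 + real n * c)) *\<^sub>R vec_of (V k) else 0)"
        by (rule sum.cong) simp_all
      then show ?thesis
        using j by (simp add: u_def regular_normal_def \<tau>_def scaleR_diff_left scaleR_diff_right
            sum_subtractf n_def mult.commute flip: scaleR_sum_right)
    qed
    finally have reflected: "r j2 *\<^sub>R vec_of (facet_reflection V j (P j2)) = (\<Sum>k\<in>{0..n}.
        (w (real k - real j2) + \<tau> * x - (if k = j then 2 * x / D * (1 + real n * c) else 0))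
          *\<^sub>R vec_of (V k))"
      by (simp add: W_def sum_subtractf[symmetric] scaleR_diff_left scaleR_add_left algebra_simps)
    define L where "L = 2 * cosh (2 * s)"
    have "r j1 *\<^sub>R vec_of (P j1) + r j2 *\<^sub>R vec_of (facet_reflection V j (P j2)) = (\<Sum>k\<in>{0..n}.
        (w (real k - real j1) + (w (real k - real j2) + \<tau> * x
          - (if k = j then 2 * x / D * (1 + real n * c) else 0))) *\<^sub>R vec_of (V k))"
      unfolding reflected P[OF j12(1), symmetric] by (simp add: W_def sum.distrib scaleR_add_left)
    also have "\<dots> = (\<Sum>k\<in>{0..n}. (L * w (real k - real j)) *\<^sub>R vec_of (V k))"
    proof (intro sum.cong refl arg_cong2[where f = scaleR])
      fix k assume k: "k \<in> {0..n}"
      show "w (real k - real j1) + (w (real k - real j2) + \<tau> * x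
          - (if k = j then 2 * x / D * (1 + real n * c) else 0)) = L * w (real k - real j)"
      proof (cases "k = j")
        case True
        have "2 * x / D * (1 + real n * c) = 2 * x + \<tau> * x"
          using D by (simp add: \<tau>_def D_def field_simps)
        then show ?thesis using True by (simp add: wj) (simp add: w_def)
      next
        case False
        then have "\<bar>real k - real j\<bar> \<ge> 1" by linarith
        then show ?thesis
          using False k w12[OF k] cyclic_weight_recurrence[OF s(2), of "real k - real j"] n
          by (simp add: w_def x_def L_def)
      qed
    qed
    also have "\<dots> = (L * r j) *\<^sub>R vec_of (P j)"
      using P[OF j] by (simp add: W_def flip: scaleR_scaleR scaleR_sum_right)
    finally have "(L * r j) *\<^sub>R vec_of (P j) =
        r j1 *\<^sub>R vec_of (P j1) + r j2 *\<^sub>R vec_of (facet_reflection V j (P j2))" by simp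
    then have "inverse (L * r j) *\<^sub>R (L * r j) *\<^sub>R vec_of (P j) =
        inverse (L * r j) *\<^sub>R (r j1 *\<^sub>R vec_of (P j1) + r j2 *\<^sub>R vec_of (facet_reflection V j (P j2)))"
      by simp
    moreover have L: "L * r j > 0" using r[OF j] by (simp add: L_def)
    then have "inverse (L * r j) * (L * r j) = 1" by (intro left_inverse less_imp_neq[symmetric])
    \<comment> \<open>Division by \<open>L * r j > 0\<close> exhibits \<open>P j\<close> in the cone
      over its predecessor and the reflected successor.\<close>
    ultimately have "vec_of (P j) = (inverse (L * r j) * r j1) *\<^sub>R vec_of (P j1)
        + (inverse (L * r j) * r j2) *\<^sub>R vec_of (facet_reflection V j (P j2))"
      by (simp only: scaleR_add_right scaleR_scaleR scaleR_one)
    moreover have "0 \<le> inverse (L * r j) * r j1" "0 \<le> inverse (L * r j) * r j2"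
      using L r[OF j12(1)] r[OF j12(2)]
      by (simp_all only: less_imp_le mult_pos_pos positive_imp_inverse_positive)
    ultimately show ?thesis
      unfolding geodesic_segment_eq j1_def[symmetric] j2_def[symmetric]
      by (intro CollectI exI[of _ "inverse (L * r j) * r j1"]
          exI[of _ "inverse (L * r j) * r j2"] conjI)
  qed
  \<comment> \<open>The \<open>j\<close>-th bounce is on facet \<open>j\<close>, so the identity
    serves as the bijection.\<close>
  have "closed_billiard_orbit V P (\<lambda>j. j)"
    unfolding closed_billiard_orbit_def n_def[symmetric]
    using facet not_facet segment facet_subset_frontier by (auto simp: n_def)
  moreover have "bij_betw (\<lambda>j. j) {0..CARD('n)} {0..CARD('n)}" by (simp add: bij_betw_def)
  ultimately show ?thesis by blast
qed

end
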